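(* Let $R$ be a commutative Noetherian ring with identity, $M$ a finitely generated unitary $R$-module, and $N$, $K$ proper submodules of $M$ with $\mathcal{P}_M(N)=\mathcal{P}_M(K)=\mathfrak{p}_1\cdots\mathfrak{p}_n$, where $\mathfrak{p}_1,\dots,\mathfrak{p}_n$ are prime ideals of $R$ (not necessarily distinct). If $\mathfrak{p}_i\not\supset\mathfrak{p}_j$ (that is, $\mathfrak{p}_i$ does not properly contain $\mathfrak{p}_j$) for every $i\neq j$, then $\mathcal{P}_M(N\cap K)=\mathcal{P}_M(N)$.
   Context: Throughout, $R$ is a commutative Noetherian ring with identity and $M$ is a finitely generated unitary $R$-module. The symbols $\subset$, $\supset$ denote proper inclusion. For submodules $N,K$ of $M$, $(N:K)=\{a\in R \mid aK\subseteq N\}$; for an ideal $I$ of $R$, $(N:I)=\{x\in M\mid Ix\subseteq N\}$. $\mathrm{Ass}(M/N)$ is the set of associated primes of $M/N$. Prime submodule: a proper submodule $N$ of $M$ is a $\mathfrak{p}$-prime submodule of $M$ if $(N:M)=\mathfrak{p}$ and for all $a\in R$, $x\in M$, $ax\in N$ implies $a\in (N:M)$ or $x\in N$ (then $\mathfrak p$ is a prime ideal). A submodule $K\supset N$ of $M$ is a $\mathfrak{p}$-prime extension of $N$, written $N\overset{\mathfrak p}{\subset}K$, if $N$ is a $\mathfrak{p}$-prime submodule of $K$. If $\mathfrak{p}$ is a maximal element (under inclusion) of $\mathrm{Ass}(M/N)$, then $(N:\mathfrak{p})$ is the unique maximal $\mathfrak{p}$-prime extension of $N$ in $M$, and it is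 called the regular $\mathfrak{p}$-prime extension of $N$ in $M$. RPE filtration: a filtration $N=M_0\overset{\mathfrak{p}_1}{\subset}M_1\subset\cdots\overset{\mathfrak{p}_n}{\subset}M_n=M$ is a regular prime extension (RPE) filtration of $M$ over $N$ if each $M_i$ is a regular $\mathfrak{p}_i$-prime extension of $M_{i-1}$ in $M$, $1\le i\le n$. Factorization: for a proper submodule $N$ of $M$, RPE filtrations of $M$ over $N$ exist, and it is known that the number of occurrences of each prime ideal is the same in all of them. The generalized prime ideal factorization of $N$ in $M$ is the formal product $\mathcal{P}_M(N)=\mathfrak{p}_1\cdots\mathfrak{p}_n$ of the primes occurring in any RPE filtration of $M$ over $N$, i.e. the multiset of these primes; equality of two such factorizations means equality as multisets of prime ideals (not merely equality of the product ideals). *)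

theory Defs
  imports "HOL-Algebra.Algebra"
begin

text \<open>Finite generation of a module, phrased as for \<^const>\<open>genideal\<close>: the submodule generated by
  \<open>A\<close> is the intersection of all submodules containing \<open>A\<close>.\<close>

definition fin_gen_module :: "('a, 'r) ring_scheme \<Rightarrow> ('a, 'b, 'm) module_scheme \<Rightarrow> bool"
  where "fin_gen_module R M \<longleftrightarrow>
    (\<exists>A \<subseteq> carrier M. finite A \<and> carrier M = \<Inter>{H. submodule H R M \<and> A \<subseteq> H})"

definition colon_ideal ::
    "('a, 'r) ring_scheme \<Rightarrow> ('a, 'b, 'm) module_scheme \<Rightarrow> 'b set \<Rightarrow> 'b set \<Rightarrow> 'a set"
  where "colon_ideal R M N K = {a \<in> carrier R. \<forall>x\<in>K. a \<odot>\<^bsub>M\<^esub> x \<in> N}"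

definition colon_submodule :: "('a, 'b, 'm) module_scheme \<Rightarrow> 'b set \<Rightarrow> 'a set \<Rightarrow> 'b set"
  where "colon_submodule M N I = {x \<in> carrier M. \<forall>a\<in>I. a \<odot>\<^bsub>M\<^esub> x \<in> N}"

text \<open>The quotient module on additive cosets; compare \<^const>\<open>FactRing\<close>. The fields \<open>mult\<close> and
  \<open>one\<close>, which the module record inherits from rings, play no role for modules.\<close>

definition quot_module :: "('a, 'b, 'm) module_scheme \<Rightarrow> 'b set \<Rightarrow> ('a, 'b set) module"
  where "quot_module M N =
    \<lparr>carrier = a_rcosets\<^bsub>M\<^esub> N, monoid.mult = undefined, one = undefined, ring.zero = N, ring.add = set_add M,
     module.smult = (\<lambda>a C. \<Union>x\<in>C. N +>\<^bsub>M\<^esub> (a \<odot>\<^bsub>M\<^esub> x))\<rparr>"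

definition Ass :: "('a, 'r) ring_scheme \<Rightarrow> ('a, 'b, 'm) module_scheme \<Rightarrow> 'a set set"
  where "Ass R M = {\<pp>. primeideal \<pp> R \<and>
    (\<exists>x\<in>carrier M. \<pp> = {a \<in> carrier R. a \<odot>\<^bsub>M\<^esub> x = \<zero>\<^bsub>M\<^esub>})}"

definition prime_submodule ::
    "('a, 'r) ring_scheme \<Rightarrow> ('a, 'b, 'm) module_scheme \<Rightarrow> 'a set \<Rightarrow> 'b set \<Rightarrow> bool"
  where "prime_submodule R M \<pp> N \<longleftrightarrow>
    submodule N R M \<and> N \<noteq> carrier M \<and> colon_ideal R M N (carrier M) = \<pp> \<and>
    (\<forall>a\<in>carrier R. \<forall>x\<in>carrier M.
       a \<odot>\<^bsub>M\<^esub> x \<in> N \<longrightarrow> a \<in> colon_ideal R M N (carrier M) \<or> x \<in> N)"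

definition prime_extension ::
    "('a, 'r) ring_scheme \<Rightarrow> ('a, 'b, 'm) module_scheme \<Rightarrow> 'a set \<Rightarrow> 'b set \<Rightarrow> 'b set \<Rightarrow> bool"
  where "prime_extension R M \<pp> N K \<longleftrightarrow>
    submodule K R M \<and> N \<subset> K \<and> prime_submodule R (M\<lparr>carrier := K\<rparr>) \<pp> N"

definition regular_prime_extension ::
    "('a, 'r) ring_scheme \<Rightarrow> ('a, 'b, 'm) module_scheme \<Rightarrow> 'a set \<Rightarrow> 'b set \<Rightarrow> 'b set \<Rightarrow> bool"
  where "regular_prime_extension R M \<pp> N K \<longleftrightarrow>
    \<pp> \<in> Ass R (quot_module M N) \<and> (\<forall>\<qq>\<in>Ass R (quot_module M N). \<not> \<pp> \<subset> \<qq>) \<and>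
    prime_extension R M \<pp> N K \<and> K = colon_submodule M N \<pp>"

text \<open>The list \<open>ps\<close> is indexed from 0, so \<open>ps ! i\<close> is the prime of the step from \<open>F i\<close> to
  \<open>F (Suc i)\<close>; the values of \<open>F\<close> beyond \<open>length ps\<close> are irrelevant.\<close>

definition RPE_filtration ::
    "('a, 'r) ring_scheme \<Rightarrow> ('a, 'b, 'm) module_scheme \<Rightarrow> 'b set \<Rightarrow> 'a set list \<Rightarrow> (nat \<Rightarrow> 'b set) \<Rightarrow> bool"
  where "RPE_filtration R M N ps F \<longleftrightarrow>
    F 0 = N \<and> F (length ps) = carrier M \<and>
    (\<forall>i < length ps. regular_prime_extension R M (ps ! i) (F i) (F (Suc i)))"

text \<open>The multiset of primes is the same for all RPE filtrations of \<open>M\<close> over a proper submodule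
  \<open>N\<close> when \<open>R\<close> is Noetherian and \<open>M\<close> is finitely generated, so the description is proper there.\<close>

definition prime_factorization_in ::
    "('a, 'r) ring_scheme \<Rightarrow> ('a, 'b, 'm) module_scheme \<Rightarrow> 'b set \<Rightarrow> 'a set multiset"
  where "prime_factorization_in R M N = (THE P. \<exists>ps F. RPE_filtration R M N ps F \<and> P = mset ps)"

end

theory Submission
  imports Defs
begin

text \<open>
  All arguments are about the ideals \<open>(N : x)\<close> of ring elements multiplying \<open>x\<close> into \<open>N\<close>; the primes
  among them are the associated primes of \<open>M / N\<close>. For a maximal associated prime \<open>p\<close>, passing
  from \<open>N\<close> to \<open>(N : p)\<close> keeps every associated prime that does not contain \<open>p\<close>
  (lemma \<open>Ass_mod_colonI\<close>) and keeps every other maximal one maximal (lemma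
  \<open>maximal_Ass_mod_colon\<close>). Since \<open>((N : p) : q) = ((N : q) : p)\<close>, two different
  first steps of filtrations can be completed to a square. Hence every maximal associated prime \<open>q\<close> of
  \<open>M / N\<close> occurs in every filtration over \<open>N\<close>, and removing one occurrence leaves the factors of
  a filtration over \<open>(N : q)\<close> (lemma \<open>RPE_factors_remove\<close>). This exchange property yields
  that the multiset of primes does not depend on the filtration; existence of filtrations is
  induction along the ascending chain condition on submodules.

  Let the factors of \<open>N\<close> and of \<open>K\<close> form the same multiset of pairwise incomparable primes.
  The associated primes of \<open>M / N\<close>, of \<open>M / K\<close>, and hence of \<open>M / (N \<inter> K)\<close>, are among the factors.
  Conversely let \<open>p\<close> be a factor. Then \<open>p\<close> contains an ideal \<open>(L : x)\<close> for \<open>L\<close> any of the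
  three submodules, so it contains an associated prime of \<open>M / L\<close> (lemma \<open>Ass_mod_below\<close>); this
  is a factor, and incomparability makes it equal to \<open>p\<close>. So \<open>p\<close> is a maximal associated prime
  in all three cases and may be taken as the first step. As
  \<open>(N : p) \<inter> (K : p) = (N \<inter> K : p)\<close>, induction on the number of factors applies to
  \<open>(N : p)\<close> and \<open>(K : p)\<close> (lemma \<open>RPE_factors_Int\<close>).
\<close>

section \<open>Annihilators modulo a submodule and associated primes\<close>

context module
begin

abbreviation ann_mod :: "'c set \<Rightarrow> 'c \<Rightarrow> 'a set"
  where "ann_mod N x \<equiv> colon_ideal R M N {x}"

abbreviation Ass_mod :: "'c set \<Rightarrow> 'a set set"
  where "Ass_mod N \<equiv> Ass R (quot_module M N)"

definition maximal_Ass_mod :: "'c set \<Rightarrow> 'a set \<Rightarrow> bool"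
  where "maximal_Ass_mod N p \<longleftrightarrow> p \<in> Ass_mod N \<and> (\<forall>q\<in>Ass_mod N. \<not> p \<subset> q)"

lemma mem_ann_mod: "a \<in> ann_mod N x \<longleftrightarrow> a \<in> carrier R \<and> a \<odot>\<^bsub>M\<^esub> x \<in> N"
  by (simp add: colon_ideal_def)

lemma smult_left_commute:
  assumes "a \<in> carrier R" "b \<in> carrier R" "x \<in> carrier M"
  shows "a \<odot>\<^bsub>M\<^esub> (b \<odot>\<^bsub>M\<^esub> x) = b \<odot>\<^bsub>M\<^esub> (a \<odot>\<^bsub>M\<^esub> x)"
  using assms by (metis smult_assoc1 R.m_comm)

lemma submodule_zero_mem: "submodule N R M \<Longrightarrow> \<zero>\<^bsub>M\<^esub> \<in> N"
  using subgroup.one_closed[OF submodule.axioms(1)] by fastforce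

lemma ideal_ann_mod:
  assumes N: "submodule N R M" and x: "x \<in> carrier M"
  shows "ideal (ann_mod N x) R"
proof (rule idealI)
  show "ring R" by (rule R.ring_axioms)
  show "subgroup (ann_mod N x) (add_monoid R)"
  proof (rule R.add.subgroupI)
    show "ann_mod N x \<subseteq> carrier R" by (auto simp: mem_ann_mod)
    have "\<zero> \<in> ann_mod N x"
      using x submodule_zero_mem[OF N] by (simp add: mem_ann_mod)
    then show "ann_mod N x \<noteq> {}" by blast
  next
    fix a assume "a \<in> ann_mod N x"
    then show "\<ominus> a \<in> ann_mod N x"
      using x submoduleE(3)[OF N] by (simp add: mem_ann_mod smult_l_minus)
  next
    fix a b assume "a \<in> ann_mod N x" "b \<in> ann_mod N x"
    then show "a \<oplus> b \<in> ann_mod N x"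
      using x submoduleE(5)[OF N] by (simp add: mem_ann_mod smult_l_distr)
  qed
next
  fix a r assume a: "a \<in> ann_mod N x" and r: "r \<in> carrier R"
  show "r \<otimes> a \<in> ann_mod N x"
    using a r x submoduleE(4)[OF N] by (simp add: mem_ann_mod smult_assoc1)
  then show "a \<otimes> r \<in> ann_mod N x"
    using a r by (simp add: mem_ann_mod R.m_comm)
qed

lemma ann_mod_smult_mono:
  assumes "submodule N R M" "x \<in> carrier M" "c \<in> carrier R"
  shows "ann_mod N x \<subseteq> ann_mod N (c \<odot>\<^bsub>M\<^esub> x)"
  using assms submoduleE(4)[OF assms(1)] by (auto simp: mem_ann_mod smult_left_commute[of _ c x])

lemma one_mem_ann_mod: "x \<in> carrier M \<Longrightarrow> \<one> \<in> ann_mod N x \<longleftrightarrow> x \<in> N"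
  by (simp add: mem_ann_mod)

lemma one_notin_primeideal: "primeideal p R \<Longrightarrow> \<one> \<notin> p"
  by (metis ideal.one_imp_carrier primeideal.I_notcarr primeideal.axioms(1))

lemma quot_module_smult:
  assumes N: "submodule N R M" and x: "x \<in> carrier M" and a: "a \<in> carrier R"
  shows "a \<odot>\<^bsub>quot_module M N\<^esub> (N +>\<^bsub>M\<^esub> x) = N +>\<^bsub>M\<^esub> (a \<odot>\<^bsub>M\<^esub> x)"
proof -
  have sg: "subgroup N (add_monoid M)" by (rule submodule.axioms(1)[OF N])
  have Nc: "N \<subseteq> carrier M" by (rule submoduleE(1)[OF N])
  have eq: "N +>\<^bsub>M\<^esub> (a \<odot>\<^bsub>M\<^esub> y) = N +>\<^bsub>M\<^esub> (a \<odot>\<^bsub>M\<^esub> x)" if y: "y \<in> N +>\<^bsub>M\<^esub> x" for y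
  proof -
    from y obtain n where n: "n \<in> N" "y = n \<oplus>\<^bsub>M\<^esub> x" by (auto simp: a_r_coset_def')
    have "a \<odot>\<^bsub>M\<^esub> y = a \<odot>\<^bsub>M\<^esub> n \<oplus>\<^bsub>M\<^esub> a \<odot>\<^bsub>M\<^esub> x" using n x a Nc by (auto simp: smult_r_distr)
    moreover have "a \<odot>\<^bsub>M\<^esub> n \<in> N" using submoduleE(4)[OF N] a n by blast
    ultimately have "a \<odot>\<^bsub>M\<^esub> y \<in> N +>\<^bsub>M\<^esub> (a \<odot>\<^bsub>M\<^esub> x)" by (auto simp: a_r_coset_def')
    then show ?thesis using M.a_repr_independence[OF _ _ sg] x a by (metis smult_closed)
  qed
  have "\<zero>\<^bsub>M\<^esub> \<oplus>\<^bsub>M\<^esub> x \<in> N +>\<^bsub>M\<^esub> x"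
    using M.a_rcosI[OF submodule_zero_mem[OF N] Nc x] .
  with eq have "(\<Union>y\<in>N +>\<^bsub>M\<^esub> x. N +>\<^bsub>M\<^esub> (a \<odot>\<^bsub>M\<^esub> y)) = N +>\<^bsub>M\<^esub> (a \<odot>\<^bsub>M\<^esub> x)" by blast
  then show ?thesis by (simp add: quot_module_def)
qed

text \<open>An element of the quotient is a coset of some \<open>x\<close>, and its annihilator is the annihilator
  of \<open>x\<close> modulo \<open>N\<close>. Everything below is phrased with representatives, so that cosets
  do not occur again.\<close>

lemma Ass_mod_iff:
  assumes N: "submodule N R M"
  shows "p \<in> Ass_mod N \<longleftrightarrow> primeideal p R \<and> (\<exists>x\<in>carrier M. p = ann_mod N x)"
proof -
  have sg: "subgroup N (add_monoid M)" by (rule submodule.axioms(1)[OF N])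
  have "{a \<in> carrier R. a \<odot>\<^bsub>quot_module M N\<^esub> (N +>\<^bsub>M\<^esub> x) = \<zero>\<^bsub>quot_module M N\<^esub>} = ann_mod N x"
    if x: "x \<in> carrier M" for x
  proof -
    have "N +>\<^bsub>M\<^esub> y = N \<longleftrightarrow> y \<in> N" if "y \<in> carrier M" for y
      using that M.a_coset_join1[OF _ that sg] M.a_coset_join2[OF that sg] by blast
    then have "a \<odot>\<^bsub>quot_module M N\<^esub> (N +>\<^bsub>M\<^esub> x) = \<zero>\<^bsub>quot_module M N\<^esub> \<longleftrightarrow> a \<odot>\<^bsub>M\<^esub> x \<in> N"
      if "a \<in> carrier R" for a
      using quot_module_smult[OF N x that] smult_closed[OF that x] by (simp add: quot_module_def)
    then show ?thesis unfolding colon_ideal_def by blast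
  qed
  moreover have "carrier (quot_module M N) = (\<lambda>x. N +>\<^bsub>M\<^esub> x) ` carrier M"
    by (auto simp: quot_module_def A_RCOSETS_def')
  ultimately show ?thesis by (auto simp: Ass_def)
qed

lemma Ass_modE:
  assumes "submodule N R M" "p \<in> Ass_mod N"
  obtains x where "x \<in> carrier M" "x \<notin> N" "primeideal p R" "p = ann_mod N x"
  using assms one_notin_primeideal one_mem_ann_mod by (metis Ass_mod_iff)

lemma Ass_mod_carrier: "Ass_mod (carrier M) = {}"
  using Ass_modE[OF carrier_is_submodule] by blast

lemma submodule_Int:
  assumes "submodule N R M" "submodule K R M"
  shows "submodule (N \<inter> K) R M"
  using submoduleE[OF assms(1)] submoduleE[OF assms(2)]
    submodule_zero_mem[OF assms(1)] submodule_zero_mem[OF assms(2)]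
  by (intro submoduleI) auto

lemma ann_mod_Int: "ann_mod (N \<inter> K) x = ann_mod N x \<inter> ann_mod K x"
  by (auto simp: mem_ann_mod)

text \<open>The quotient by \<open>N \<inter> K\<close> embeds into the direct sum of the two quotients. On annihilators this
  says that a prime which is the intersection of two ideals equals one of them.\<close>

lemma Ass_mod_Int:
  assumes N: "submodule N R M" and K: "submodule K R M"
  shows "Ass_mod (N \<inter> K) \<subseteq> Ass_mod N \<union> Ass_mod K"
proof
  fix p assume "p \<in> Ass_mod (N \<inter> K)"
  then obtain x where x: "x \<in> carrier M" and p: "primeideal p R" and px: "p = ann_mod (N \<inter> K) x"
    using Ass_modE[OF submodule_Int[OF N K]] by blast
  have "p = ann_mod N x \<or> p = ann_mod K x"
  proof (rule ccontr)
    assume ne: "\<not> ?thesis"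
    have "p \<subseteq> ann_mod N x" "p \<subseteq> ann_mod K x" using px ann_mod_Int by auto
    then have "\<not> ann_mod N x \<subseteq> p" "\<not> ann_mod K x \<subseteq> p" using ne by auto
    then obtain a b where a: "a \<in> ann_mod N x" "a \<notin> p" and b: "b \<in> ann_mod K x" "b \<notin> p"
      by blast
    have c: "a \<in> carrier R" "b \<in> carrier R" using a b by (simp_all add: mem_ann_mod)
    have "a \<otimes> b \<in> p"
      using ideal.I_r_closed[OF ideal_ann_mod[OF N x] a(1) c(2)]
        ideal.I_l_closed[OF ideal_ann_mod[OF K x] b(1) c(1)] px by (simp add: ann_mod_Int)
    then show False using primeideal.I_prime[OF p c] a b by blast
  qed
  then show "p \<in> Ass_mod N \<union> Ass_mod K" using p x N K Ass_mod_iff by auto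
qed

section \<open>The submodule of elements multiplied into a submodule by a prime\<close>

lemma submodule_colon:
  assumes N: "submodule N R M" and I: "I \<subseteq> carrier R"
  shows "submodule (colon_submodule M N I) R M"
proof (rule submoduleI)
  show "colon_submodule M N I \<subseteq> carrier M" by (auto simp: colon_submodule_def)
  show "\<zero>\<^bsub>M\<^esub> \<in> colon_submodule M N I"
    using I submodule_zero_mem[OF N] by (simp add: colon_submodule_def subset_iff)
  show "\<ominus>\<^bsub>M\<^esub> x \<in> colon_submodule M N I" if "x \<in> colon_submodule M N I" for x
    using that I submoduleE(3)[OF N] by (simp add: colon_submodule_def subset_iff smult_r_minus)
  show "x \<oplus>\<^bsub>M\<^esub> y \<in> colon_submodule M N I"
    if "x \<in> colon_submodule M N I" "y \<in> colon_submodule M N I" for x y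
    using that I submoduleE(5)[OF N] by (simp add: colon_submodule_def subset_iff smult_r_distr)
  show "c \<odot>\<^bsub>M\<^esub> x \<in> colon_submodule M N I"
    if "c \<in> carrier R" "x \<in> colon_submodule M N I" for c x
    using that I submoduleE(4)[OF N]
    by (simp add: colon_submodule_def subset_iff smult_left_commute[of _ c x])
qed

lemma colon_submodule_Int:
  "colon_submodule M (N \<inter> K) I = colon_submodule M N I \<inter> colon_submodule M K I"
  by (auto simp: colon_submodule_def)

lemma Ass_mod_subset_carrier: "p \<in> Ass_mod N \<Longrightarrow> p \<subseteq> carrier R"
  by (auto simp: Ass_def)

lemma submodule_colon_Ass:
  assumes "submodule N R M" "p \<in> Ass_mod N"
  shows "submodule (colon_submodule M N p) R M"
  using submodule_colon[OF assms(1) Ass_mod_subset_carrier[OF assms(2)]] .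

lemma colon_submodule_superset:
  assumes "submodule N R M" "I \<subseteq> carrier R"
  shows "N \<subseteq> colon_submodule M N I"
  using submoduleE(1,4)[OF assms(1)] assms(2) by (auto simp: colon_submodule_def)

lemma colon_submodule_commute:
  assumes "I \<subseteq> carrier R" "J \<subseteq> carrier R"
  shows "colon_submodule M (colon_submodule M N I) J = colon_submodule M (colon_submodule M N J) I"
proof -
  have "a \<odot>\<^bsub>M\<^esub> (b \<odot>\<^bsub>M\<^esub> x) = b \<odot>\<^bsub>M\<^esub> (a \<odot>\<^bsub>M\<^esub> x)" "a \<odot>\<^bsub>M\<^esub> x \<in> carrier M"
    "b \<odot>\<^bsub>M\<^esub> x \<in> carrier M"
    if "a \<in> I" "b \<in> J" "x \<in> carrier M" for a b x
    using that assms smult_left_commute[of a b x] by auto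
  then show ?thesis
    using assms by (fastforce simp: colon_submodule_def)
qed

lemma colon_submodule_Ass_psubset:
  assumes N: "submodule N R M" and p: "p \<in> Ass_mod N"
  shows "N \<subset> colon_submodule M N p"
proof -
  obtain x where x: "x \<in> carrier M" "x \<notin> N" "p = ann_mod N x"
    using Ass_modE[OF N p] by blast
  have "x \<in> colon_submodule M N p"
    using x(1) by (simp add: x(3) colon_submodule_def mem_ann_mod)
  then show ?thesis
    using x(2) colon_submodule_superset[OF N Ass_mod_subset_carrier[OF p]] by blast
qed

text \<open>If \<open>q\<close> is the annihilator of \<open>x\<close> modulo \<open>N\<close> and \<open>p\<close> has an element \<open>a\<close> outside \<open>q\<close>, then
  multiplying by \<open>a\<close> is harmless modulo the prime \<open>q\<close>: an element that multiplies \<open>p x\<close> into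
  \<open>N\<close> multiplies \<open>a x\<close> into \<open>N\<close> and therefore lies in \<open>q\<close>. So \<open>x\<close> has annihilator \<open>q\<close>
  modulo \<open>(N : p)\<close> as well.\<close>

lemma Ass_mod_colonI:
  assumes N: "submodule N R M" and p: "p \<in> Ass_mod N" and q: "q \<in> Ass_mod N" and pq: "\<not> p \<subseteq> q"
  shows "q \<in> Ass_mod (colon_submodule M N p)"
proof -
  obtain x where x: "x \<in> carrier M" and qp: "primeideal q R" and qx: "q = ann_mod N x"
    using Ass_modE[OF N q] by blast
  note q_prime = primeideal.I_prime[OF qp]
  obtain a where a: "a \<in> p" "a \<notin> q" "a \<in> carrier R"
    using pq Ass_mod_subset_carrier[OF p] by blast
  have "ann_mod (colon_submodule M N p) x = q"
  proof
    show "ann_mod (colon_submodule M N p) x \<subseteq> q"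
    proof
      fix b assume "b \<in> ann_mod (colon_submodule M N p) x"
      then have b: "b \<in> carrier R" "a \<odot>\<^bsub>M\<^esub> (b \<odot>\<^bsub>M\<^esub> x) \<in> N"
        using a by (auto simp: mem_ann_mod colon_submodule_def)
      then have "a \<otimes> b \<in> q" using a x qx by (simp add: mem_ann_mod smult_assoc1)
      then show "b \<in> q" using q_prime[of a b] a b by blast
    qed
    show "q \<subseteq> ann_mod (colon_submodule M N p) x"
      using colon_submodule_superset[OF N Ass_mod_subset_carrier[OF p]] qx
      by (auto simp: mem_ann_mod)
  qed
  then show ?thesis
    unfolding Ass_mod_iff[OF submodule_colon_Ass[OF N p]]
    using qp x by (intro conjI bexI[of _ x]) simp_all
qed

end

section \<open>Consequences of the Noetherian condition on the ring\<close>

lemma (in noetherian_ring) nonempty_ideals_have_maximal: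
  assumes "S \<noteq> {}" and "\<And>I. I \<in> S \<Longrightarrow> ideal I R"
  shows "\<exists>I\<in>S. \<forall>J\<in>S. I \<subseteq> J \<longrightarrow> J = I"
proof (rule subset_Zorn_nonempty[OF assms(1)])
  fix C assume C: "C \<noteq> {}" "subset.chain S C"
  have CS: "C \<subseteq> S" using C(2) by (simp add: pred_on.chain_def)
  then have "C \<subseteq> {I. ideal I R}" using assms(2) by auto
  then have "subset.chain {I. ideal I R} C" using C(2) by (simp add: pred_on.chain_def)
  then have "\<Union>C \<in> C" by (rule ideal_chain_is_trivial[OF C(1)])
  then show "\<Union>C \<in> S" using CS by (rule subsetD[rotated])
qed

lemma (in noetherian_ring) wf_ideals: "wf {(J, I). ideal I R \<and> ideal J R \<and> I \<subset> J}"
proof (rule wfI_min)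
  fix I and Q :: "'a set set" assume I: "I \<in> Q"
  show "\<exists>I\<in>Q. \<forall>J. (J, I) \<in> {(J, I). ideal I R \<and> ideal J R \<and> I \<subset> J} \<longrightarrow> J \<notin> Q"
  proof (cases "\<exists>I\<in>Q. ideal I R")
    case True
    then have "{I \<in> Q. ideal I R} \<noteq> {}" by blast
    then have "\<exists>I\<in>{I \<in> Q. ideal I R}. \<forall>J\<in>{I \<in> Q. ideal I R}. I \<subseteq> J \<longrightarrow> J = I"
      by (rule nonempty_ideals_have_maximal) simp
    then obtain I where I: "I \<in> Q" and max: "\<And>J. J \<in> Q \<Longrightarrow> ideal J R \<Longrightarrow> I \<subseteq> J \<Longrightarrow> J = I"
      by auto
    show ?thesis
    proof (intro bexI[OF _ I] allI impI)
      fix J assume "(J, I) \<in> {(J, I). ideal I R \<and> ideal J R \<and> I \<subset> J}"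
      then have "ideal J R" "I \<subset> J" by auto
      then show "J \<notin> Q" using max[of J] by auto
    qed
  next
    case False
    then show ?thesis using I by blast
  qed
qed

locale module_over_noetherian = module +
  assumes noetherian: "noetherian_ring R"
begin

text \<open>Among the annihilators of elements outside \<open>N\<close>, a maximal one is prime: if \<open>a\<close> does not
  multiply \<open>y\<close> into \<open>N\<close>, then \<open>a y\<close> is a competitor with at least the annihilator of \<open>y\<close>.\<close>

lemma maximal_Ass_mod_above:
  assumes N: "submodule N R M" and x: "x \<in> carrier M" "x \<notin> N"
  shows "\<exists>p. maximal_Ass_mod N p \<and> ann_mod N x \<subseteq> p"
proof -
  define S where "S = {ann_mod N y | y. y \<in> carrier M \<and> y \<notin> N \<and> ann_mod N x \<subseteq> ann_mod N y}"
  have "\<exists>I\<in>S. \<forall>J\<in>S. I \<subseteq> J \<longrightarrow> J = I"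
  proof (rule noetherian_ring.nonempty_ideals_have_maximal[OF noetherian])
    show "S \<noteq> {}" using x unfolding S_def by blast
    show "ideal I R" if "I \<in> S" for I using that ideal_ann_mod[OF N] unfolding S_def by blast
  qed
  then obtain I where I: "I \<in> S" and I_max: "\<forall>J\<in>S. I \<subseteq> J \<longrightarrow> J = I" by (rule bexE)
  from I obtain y where Iy: "I = ann_mod N y" and y: "y \<in> carrier M" "y \<notin> N"
    and xy: "ann_mod N x \<subseteq> ann_mod N y"
    unfolding S_def by blast
  have max: "J = ann_mod N y" if "J \<in> S" "ann_mod N y \<subseteq> J" for J
    using I_max that unfolding Iy by blast
  have pr: "primeideal (ann_mod N y) R"
  proof (rule primeidealI)
    show "ideal (ann_mod N y) R" by (rule ideal_ann_mod[OF N y(1)])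
    show "cring R" by (rule R.is_cring)
    show "carrier R \<noteq> ann_mod N y" using y one_mem_ann_mod R.one_closed by blast
    fix a b assume ab: "a \<in> carrier R" "b \<in> carrier R" "a \<otimes> b \<in> ann_mod N y"
    show "a \<in> ann_mod N y \<or> b \<in> ann_mod N y"
    proof (rule disjCI, rule ccontr)
      assume nb: "b \<notin> ann_mod N y" and "a \<notin> ann_mod N y"
      then have ay: "a \<odot>\<^bsub>M\<^esub> y \<notin> N" using ab by (simp add: mem_ann_mod)
      have le: "ann_mod N y \<subseteq> ann_mod N (a \<odot>\<^bsub>M\<^esub> y)" by (rule ann_mod_smult_mono[OF N y(1) ab(1)])
      have "ann_mod N (a \<odot>\<^bsub>M\<^esub> y) \<in> S"
        using ay le xy smult_closed[OF ab(1) y(1)] unfolding S_def by blast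
      then have "ann_mod N (a \<odot>\<^bsub>M\<^esub> y) = ann_mod N y" using max le by blast
      moreover have "b \<in> ann_mod N (a \<odot>\<^bsub>M\<^esub> y)"
        using ab y by (simp add: mem_ann_mod smult_assoc1 smult_left_commute[of b a y])
      ultimately show False using nb by simp
    qed
  qed
  have "\<not> ann_mod N y \<subset> q" if q: "q \<in> Ass_mod N" for q
  proof
    assume lt: "ann_mod N y \<subset> q"
    obtain z where z: "z \<in> carrier M" "z \<notin> N" and qz: "q = ann_mod N z" by (rule Ass_modE[OF N q])
    have "ann_mod N x \<subseteq> ann_mod N z" using lt xy unfolding qz by (meson psubsetE subset_trans)
    then have "q \<in> S" using z unfolding S_def qz by blast
    then show False using max[of q] lt by blast
  qed
  moreover have "ann_mod N y \<in> Ass_mod N" using pr y(1) Ass_mod_iff[OF N] by blast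
  ultimately show ?thesis using xy unfolding maximal_Ass_mod_def by blast
qed

text \<open>This replaces the fact that a minimal prime of the support is associated. Choose an
  annihilator that is maximal among those contained in \<open>p\<close>. If \<open>a b\<close> lies in the annihilator of \<open>y\<close>
  but \<open>b\<close> does not, then the annihilator of \<open>a y\<close> is too large to lie in \<open>p\<close>, so some \<open>s \<notin> p\<close>
  satisfies \<open>s a y \<in> N\<close>. The annihilator of \<open>s y\<close> is still contained in \<open>p\<close>, because \<open>p\<close> is prime,
  hence by maximality it is that of \<open>y\<close>; and it contains \<open>a\<close>.\<close>

lemma Ass_mod_below:
  assumes N: "submodule N R M" and x: "x \<in> carrier M" and p: "primeideal p R"
    and xp: "ann_mod N x \<subseteq> p"
  shows "\<exists>q\<in>Ass_mod N. q \<subseteq> p"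
proof -
  note p_prime = primeideal.I_prime[OF p]
  define S where "S = {ann_mod N y | y. y \<in> carrier M \<and> ann_mod N y \<subseteq> p}"
  have "\<exists>I\<in>S. \<forall>J\<in>S. I \<subseteq> J \<longrightarrow> J = I"
  proof (rule noetherian_ring.nonempty_ideals_have_maximal[OF noetherian])
    show "S \<noteq> {}" using x xp unfolding S_def by blast
    show "ideal I R" if "I \<in> S" for I using that ideal_ann_mod[OF N] unfolding S_def by blast
  qed
  then obtain I where I: "I \<in> S" and I_max: "\<forall>J\<in>S. I \<subseteq> J \<longrightarrow> J = I" by (rule bexE)
  from I obtain y where Iy: "I = ann_mod N y" and y: "y \<in> carrier M" and yp: "ann_mod N y \<subseteq> p"
    unfolding S_def by blast
  have max: "J = ann_mod N y" if "J \<in> S" "ann_mod N y \<subseteq> J" for J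
    using I_max that unfolding Iy by blast
  have "primeideal (ann_mod N y) R"
  proof (rule primeidealI)
    show "ideal (ann_mod N y) R" by (rule ideal_ann_mod[OF N y])
    show "cring R" by (rule R.is_cring)
    show "carrier R \<noteq> ann_mod N y" using yp one_notin_primeideal[OF p] by blast
    fix a b assume ab: "a \<in> carrier R" "b \<in> carrier R" "a \<otimes> b \<in> ann_mod N y"
    show "a \<in> ann_mod N y \<or> b \<in> ann_mod N y"
    proof (rule disjCI)
      assume nb: "b \<notin> ann_mod N y"
      have le: "ann_mod N y \<subseteq> ann_mod N (a \<odot>\<^bsub>M\<^esub> y)" by (rule ann_mod_smult_mono[OF N y ab(1)])
      have "b \<in> ann_mod N (a \<odot>\<^bsub>M\<^esub> y)"
        using ab y by (simp add: mem_ann_mod smult_assoc1 smult_left_commute[of b a y])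
      then have "ann_mod N (a \<odot>\<^bsub>M\<^esub> y) \<notin> S" using max le nb by blast
      then have "\<not> ann_mod N (a \<odot>\<^bsub>M\<^esub> y) \<subseteq> p"
        using smult_closed[OF ab(1) y] unfolding S_def by blast
      then obtain s where s: "s \<in> carrier R" "s \<notin> p" "s \<odot>\<^bsub>M\<^esub> (a \<odot>\<^bsub>M\<^esub> y) \<in> N"
        unfolding subset_iff mem_ann_mod by blast
      have "ann_mod N (s \<odot>\<^bsub>M\<^esub> y) \<subseteq> p"
      proof
        fix c assume c: "c \<in> ann_mod N (s \<odot>\<^bsub>M\<^esub> y)"
        then have cR: "c \<in> carrier R" by (simp add: mem_ann_mod)
        have "c \<otimes> s \<in> ann_mod N y" using c s y by (simp add: mem_ann_mod smult_assoc1)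
        then have "c \<otimes> s \<in> p" using yp by (rule subsetD[rotated])
        then show "c \<in> p" using s p_prime[OF cR s(1)] by simp
      qed
      then have "ann_mod N (s \<odot>\<^bsub>M\<^esub> y) \<in> S"
        using smult_closed[OF s(1) y] unfolding S_def by blast
      then have "ann_mod N (s \<odot>\<^bsub>M\<^esub> y) = ann_mod N y"
        using max ann_mod_smult_mono[OF N y s(1)] by blast
      moreover have "a \<in> ann_mod N (s \<odot>\<^bsub>M\<^esub> y)"
        using s ab y by (simp add: mem_ann_mod smult_left_commute[of a s y])
      ultimately show "a \<in> ann_mod N y" by simp
    qed
  qed
  then show ?thesis using y yp Ass_mod_iff[OF N] by blast
qed

text \<open>A maximal associated prime stays maximal when another one is divided out, since no
  annihilator modulo the larger submodule \<open>(N : p)\<close> can exceed all annihilators modulo \<open>N\<close>: it is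
  contained in the annihilator modulo \<open>N\<close> of some multiple \<open>a x \<notin> N\<close> with \<open>a \<in> p\<close>.\<close>

lemma maximal_Ass_mod_colon:
  assumes N: "submodule N R M" and p: "maximal_Ass_mod N p" and q: "maximal_Ass_mod N q"
    and ne: "p \<noteq> q"
  shows "maximal_Ass_mod (colon_submodule M N p) q"
proof -
  let ?L = "colon_submodule M N p"
  have pA: "p \<in> Ass_mod N" and qA: "q \<in> Ass_mod N"
    using p q by (auto simp: maximal_Ass_mod_def)
  have "\<not> p \<subseteq> q" using p qA ne unfolding maximal_Ass_mod_def by blast
  then have qL: "q \<in> Ass_mod ?L" by (rule Ass_mod_colonI[OF N pA qA])
  have L: "submodule ?L R M" by (rule submodule_colon_Ass[OF N pA])
  have "\<not> q \<subset> r" if r: "r \<in> Ass_mod ?L" for r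
  proof -
    obtain x where x: "x \<in> carrier M" "x \<notin> ?L" "r = ann_mod ?L x"
      using Ass_modE[OF L r] by blast
    then obtain a where a: "a \<in> p" "a \<odot>\<^bsub>M\<^esub> x \<notin> N" by (auto simp: colon_submodule_def)
    then have aR: "a \<in> carrier R" using Ass_mod_subset_carrier[OF pA] by blast
    have "r \<subseteq> ann_mod N (a \<odot>\<^bsub>M\<^esub> x)"
      using x(1) a(1) aR
      by (auto simp: x(3) mem_ann_mod colon_submodule_def smult_left_commute[of _ a x])
    moreover obtain t where "maximal_Ass_mod N t" and t: "ann_mod N (a \<odot>\<^bsub>M\<^esub> x) \<subseteq> t"
      using maximal_Ass_mod_above[OF N smult_closed[OF aR x(1)] a(2)] by blast
    then have "\<not> q \<subset> t" using q by (simp add: maximal_Ass_mod_def)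
    ultimately show ?thesis using t by (meson order_trans psubset_subset_trans)
  qed
  then show ?thesis using qL by (simp add: maximal_Ass_mod_def)
qed

lemma regular_prime_extension_iff:
  assumes N: "submodule N R M"
  shows "regular_prime_extension R M p N K \<longleftrightarrow>
    maximal_Ass_mod N p \<and> K = colon_submodule M N p"
proof
  assume r: "maximal_Ass_mod N p \<and> K = colon_submodule M N p"
  then have pA: "p \<in> Ass_mod N" and K: "K = colon_submodule M N p"
    and max: "\<forall>q\<in>Ass_mod N. \<not> p \<subset> q" by (auto simp: maximal_Ass_mod_def)
  have sK: "submodule K R M" using submodule_colon_Ass[OF N pA] K by simp
  have NK: "N \<subset> K" using colon_submodule_Ass_psubset[OF N pA] K by simp
  \<comment> \<open>The annihilator of \<open>x\<close> modulo \<open>N\<close> contains \<open>p\<close> because \<open>x \<in> K\<close>, and it lies in an associated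
    prime because \<open>x \<notin> N\<close>; by maximality of \<open>p\<close> this prime is \<open>p\<close>.\<close>
  have key: "a \<in> p" if a: "a \<in> carrier R" and x: "x \<in> K" "x \<notin> N" "a \<odot>\<^bsub>M\<^esub> x \<in> N" for a x
  proof -
    have xc: "x \<in> carrier M" and px: "p \<subseteq> ann_mod N x"
      using x K Ass_mod_subset_carrier[OF pA] by (auto simp: colon_submodule_def mem_ann_mod)
    obtain q where "q \<in> Ass_mod N" "ann_mod N x \<subseteq> q"
      using maximal_Ass_mod_above[OF N xc x(2)] by (auto simp: maximal_Ass_mod_def)
    then have "ann_mod N x \<subseteq> p" using px max by blast
    then show ?thesis using a x by (auto simp: mem_ann_mod)
  qed
  have col: "colon_ideal R (M\<lparr>carrier := K\<rparr>) N K = p"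
  proof
    show "colon_ideal R (M\<lparr>carrier := K\<rparr>) N K \<subseteq> p"
      using key NK by (auto simp: colon_ideal_def)
    show "p \<subseteq> colon_ideal R (M\<lparr>carrier := K\<rparr>) N K"
      using K Ass_mod_subset_carrier[OF pA] by (auto simp: colon_ideal_def colon_submodule_def)
  qed
  have "submodule N R (M\<lparr>carrier := K\<rparr>)"
    using NK submodule.submodule_is_module[OF sK module_axioms]
      module.module_incl_imp_submodule[of R "M\<lparr>carrier := K\<rparr>" N]
      submodule.submodule_is_module[OF N module_axioms] by simp
  then have "prime_submodule R (M\<lparr>carrier := K\<rparr>) p N"
    using NK col key by (auto simp: prime_submodule_def)
  then show "regular_prime_extension R M p N K"
    using sK NK pA max K by (simp add: regular_prime_extension_def prime_extension_def)
qed (simp add: regular_prime_extension_def maximal_Ass_mod_def)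

section \<open>Submodules of a finitely generated module\<close>

text \<open>A submodule \<open>L\<close> of \<open>T + R x\<close> is determined, within any chain, by \<open>L \<inter> T\<close> and the ideal of the
  coefficients of \<open>x\<close> in elements of \<open>L\<close>. So a strict increase of \<open>L\<close> is a lexicographic
  increase of this pair.\<close>

lemma wf_submodules_of_sum_cyclic:
  assumes T: "submodule T R M" and x: "x \<in> carrier M"
    and wfT: "wf {(L', L). submodule L R M \<and> submodule L' R M \<and> L \<subset> L' \<and> L' \<subseteq> T}"
    and U: "U \<subseteq> {t \<oplus>\<^bsub>M\<^esub> a \<odot>\<^bsub>M\<^esub> x | t a. t \<in> T \<and> a \<in> carrier R}"
  shows "wf {(L', L). submodule L R M \<and> submodule L' R M \<and> L \<subset> L' \<and> L' \<subseteq> U}"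
proof -
  define co where "co L = {a \<in> carrier R. \<exists>t\<in>T. t \<oplus>\<^bsub>M\<^esub> a \<odot>\<^bsub>M\<^esub> x \<in> L}" for L
  have Tc: "T \<subseteq> carrier M" by (rule submoduleE(1)[OF T])
  have co_ideal: "ideal (co L) R" if L: "submodule L R M" for L
  proof (rule idealI)
    show "ring R" by (rule R.ring_axioms)
    show "subgroup (co L) (add_monoid R)"
    proof (rule R.add.subgroupI)
      show "co L \<subseteq> carrier R" by (auto simp: co_def)
      have "\<zero> \<in> co L"
        using submodule_zero_mem[OF T] submodule_zero_mem[OF L] x by (force simp: co_def)
      then show "co L \<noteq> {}" by blast
    next
      fix a assume "a \<in> co L"
      then obtain t where t: "a \<in> carrier R" "t \<in> T" "t \<oplus>\<^bsub>M\<^esub> a \<odot>\<^bsub>M\<^esub> x \<in> L" by (auto simp: co_def)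
      have "\<ominus>\<^bsub>M\<^esub> (t \<oplus>\<^bsub>M\<^esub> a \<odot>\<^bsub>M\<^esub> x) = \<ominus>\<^bsub>M\<^esub> t \<oplus>\<^bsub>M\<^esub> (\<ominus> a) \<odot>\<^bsub>M\<^esub> x"
        using t x Tc by (auto simp: M.minus_add smult_l_minus)
      then show "\<ominus> a \<in> co L"
        using submoduleE(3)[OF L t(3)] submoduleE(3)[OF T t(2)] t by (auto simp: co_def)
    next
      fix a b assume "a \<in> co L" "b \<in> co L"
      then obtain t u where t: "a \<in> carrier R" "t \<in> T" "t \<oplus>\<^bsub>M\<^esub> a \<odot>\<^bsub>M\<^esub> x \<in> L"
        and u: "b \<in> carrier R" "u \<in> T" "u \<oplus>\<^bsub>M\<^esub> b \<odot>\<^bsub>M\<^esub> x \<in> L" by (auto simp: co_def)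
      have "t \<in> carrier M" "u \<in> carrier M" using t u Tc by auto
      then have "(t \<oplus>\<^bsub>M\<^esub> a \<odot>\<^bsub>M\<^esub> x) \<oplus>\<^bsub>M\<^esub> (u \<oplus>\<^bsub>M\<^esub> b \<odot>\<^bsub>M\<^esub> x) = (t \<oplus>\<^bsub>M\<^esub> u) \<oplus>\<^bsub>M\<^esub> (a \<oplus> b) \<odot>\<^bsub>M\<^esub> x"
        using t u x by (simp add: smult_l_distr M.a_ac)
      then show "a \<oplus> b \<in> co L"
        using submoduleE(5)[OF L t(3) u(3)] submoduleE(5)[OF T t(2) u(2)] t u
        by (auto simp: co_def)
    qed
  next
    fix a r assume "a \<in> co L" and r: "r \<in> carrier R"
    then obtain t where t: "a \<in> carrier R" "t \<in> T" "t \<oplus>\<^bsub>M\<^esub> a \<odot>\<^bsub>M\<^esub> x \<in> L" by (auto simp: co_def)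
    have "r \<odot>\<^bsub>M\<^esub> (t \<oplus>\<^bsub>M\<^esub> a \<odot>\<^bsub>M\<^esub> x) = r \<odot>\<^bsub>M\<^esub> t \<oplus>\<^bsub>M\<^esub> (r \<otimes> a) \<odot>\<^bsub>M\<^esub> x"
      using t x r Tc by (auto simp: smult_r_distr smult_assoc1)
    then show "r \<otimes> a \<in> co L"
      using submoduleE(4)[OF L r t(3)] submoduleE(4)[OF T r t(2)] t r by (auto simp: co_def)
    then show "a \<otimes> r \<in> co L" using t r by (simp add: R.m_comm)
  qed
  have eqI: "L' \<subseteq> L"
    if L: "submodule L R M" and L': "submodule L' R M" and le: "L \<subseteq> L'" and L'U: "L' \<subseteq> U"
      and 1: "L' \<inter> T \<subseteq> L \<inter> T" and 2: "co L' \<subseteq> co L" for L L'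
  proof
    fix l assume l: "l \<in> L'"
    then obtain t a where t: "t \<in> T" and a: "a \<in> carrier R" and lt: "l = t \<oplus>\<^bsub>M\<^esub> a \<odot>\<^bsub>M\<^esub> x"
      using L'U U by blast
    then have "a \<in> co L" using 2 l by (auto simp: co_def)
    then obtain u where u: "u \<in> T" "u \<oplus>\<^bsub>M\<^esub> a \<odot>\<^bsub>M\<^esub> x \<in> L" by (auto simp: co_def)
    have c: "t \<in> carrier M" "u \<in> carrier M" "a \<odot>\<^bsub>M\<^esub> x \<in> carrier M" using t u a x Tc by auto
    have d: "l \<oplus>\<^bsub>M\<^esub> \<ominus>\<^bsub>M\<^esub> (u \<oplus>\<^bsub>M\<^esub> a \<odot>\<^bsub>M\<^esub> x) = t \<oplus>\<^bsub>M\<^esub> \<ominus>\<^bsub>M\<^esub> u"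
      using c by (simp add: lt M.minus_add M.a_ac M.r_neg M.r_neg1 M.r_neg2)
    have "l \<oplus>\<^bsub>M\<^esub> \<ominus>\<^bsub>M\<^esub> (u \<oplus>\<^bsub>M\<^esub> a \<odot>\<^bsub>M\<^esub> x) \<in> L'"
      using submoduleE(5)[OF L' l] submoduleE(3)[OF L'] u le by blast
    moreover have "t \<oplus>\<^bsub>M\<^esub> \<ominus>\<^bsub>M\<^esub> u \<in> T" using submoduleE(3,5)[OF T] t u by blast
    ultimately have "t \<oplus>\<^bsub>M\<^esub> \<ominus>\<^bsub>M\<^esub> u \<in> L" using 1 d by auto
    from submoduleE(5)[OF L this u(2)]
    show "l \<in> L" using c by (simp add: lt M.a_assoc M.r_neg1 M.r_neg2)
  qed
  let ?rT = "{(L', L). submodule L R M \<and> submodule L' R M \<and> L \<subset> L' \<and> L' \<subseteq> T}"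
  let ?rI = "{(J, I). ideal I R \<and> ideal J R \<and> I \<subset> J}"
  have "wf (inv_image (?rT <*lex*> ?rI) (\<lambda>L. (L \<inter> T, co L)))"
    by (intro wf_inv_image wf_lex_prod wfT noetherian_ring.wf_ideals[OF noetherian])
  then show ?thesis
  proof (rule wf_subset)
    show "{(L', L). submodule L R M \<and> submodule L' R M \<and> L \<subset> L' \<and> L' \<subseteq> U}
      \<subseteq> inv_image (?rT <*lex*> ?rI) (\<lambda>L. (L \<inter> T, co L))"
    proof (rule subrelI)
      fix L' L
      assume "(L', L) \<in> {(L', L). submodule L R M \<and> submodule L' R M \<and> L \<subset> L' \<and> L' \<subseteq> U}"
      then have L: "submodule L R M" and L': "submodule L' R M" and lt: "L \<subset> L'" "L' \<subseteq> U"
        by auto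
      have m: "L \<inter> T \<subseteq> L' \<inter> T" "co L \<subseteq> co L'" using lt by (auto simp: co_def)
      have "L \<inter> T \<subset> L' \<inter> T \<or> (L \<inter> T = L' \<inter> T \<and> co L \<subset> co L')"
        using eqI[OF L L'] lt m by blast
      then show "(L', L) \<in> inv_image (?rT <*lex*> ?rI) (\<lambda>L. (L \<inter> T, co L))"
        using submodule_Int[OF L T] submodule_Int[OF L' T] co_ideal[OF L] co_ideal[OF L'] by auto
    qed
  qed
qed

lemma submodule_generated:
  assumes "S \<subseteq> carrier M"
  shows "submodule (\<Inter>{H. submodule H R M \<and> S \<subseteq> H}) R M"
proof (rule submoduleI)
  show "\<Inter>{H. submodule H R M \<and> S \<subseteq> H} \<subseteq> carrier M"
    using carrier_is_submodule assms by blast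
qed (simp_all add: submodule_zero_mem submoduleE(3-5))

lemma submodule_sum_cyclic:
  assumes T: "submodule T R M" and x: "x \<in> carrier M"
  shows "submodule {t \<oplus>\<^bsub>M\<^esub> a \<odot>\<^bsub>M\<^esub> x | t a. t \<in> T \<and> a \<in> carrier R} R M" (is "submodule ?U R M")
proof (rule submoduleI)
  have Tc: "T \<subseteq> carrier M" by (rule submoduleE(1)[OF T])
  show "?U \<subseteq> carrier M" using Tc x by auto
  have "\<zero>\<^bsub>M\<^esub> = \<zero>\<^bsub>M\<^esub> \<oplus>\<^bsub>M\<^esub> \<zero> \<odot>\<^bsub>M\<^esub> x" using x by simp
  then show "\<zero>\<^bsub>M\<^esub> \<in> ?U" using submodule_zero_mem[OF T] R.zero_closed by blast
  show "\<ominus>\<^bsub>M\<^esub> u \<in> ?U" if "u \<in> ?U" for u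
  proof -
    from that obtain t a where t: "t \<in> T" "a \<in> carrier R" "u = t \<oplus>\<^bsub>M\<^esub> a \<odot>\<^bsub>M\<^esub> x" by blast
    then have "\<ominus>\<^bsub>M\<^esub> u = \<ominus>\<^bsub>M\<^esub> t \<oplus>\<^bsub>M\<^esub> (\<ominus> a) \<odot>\<^bsub>M\<^esub> x"
      using x Tc by (auto simp: M.minus_add smult_l_minus)
    then show ?thesis using submoduleE(3)[OF T t(1)] R.a_inv_closed[OF t(2)] by blast
  qed
  show "u \<oplus>\<^bsub>M\<^esub> v \<in> ?U" if "u \<in> ?U" "v \<in> ?U" for u v
  proof -
    from that obtain t a s b where t: "t \<in> T" "a \<in> carrier R" "u = t \<oplus>\<^bsub>M\<^esub> a \<odot>\<^bsub>M\<^esub> x"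
      and s: "s \<in> T" "b \<in> carrier R" "v = s \<oplus>\<^bsub>M\<^esub> b \<odot>\<^bsub>M\<^esub> x" by blast
    have "t \<in> carrier M" "s \<in> carrier M" using t s Tc by auto
    then have "u \<oplus>\<^bsub>M\<^esub> v = (t \<oplus>\<^bsub>M\<^esub> s) \<oplus>\<^bsub>M\<^esub> (a \<oplus> b) \<odot>\<^bsub>M\<^esub> x"
      using x t s by (simp add: smult_l_distr M.a_ac)
    then show ?thesis using submoduleE(5)[OF T t(1) s(1)] R.a_closed[OF t(2) s(2)] by blast
  qed
  show "r \<odot>\<^bsub>M\<^esub> u \<in> ?U" if r: "r \<in> carrier R" and u: "u \<in> ?U" for r u
  proof -
    from u obtain t a where t: "t \<in> T" "a \<in> carrier R" "u = t \<oplus>\<^bsub>M\<^esub> a \<odot>\<^bsub>M\<^esub> x" by blast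
    then have "r \<odot>\<^bsub>M\<^esub> u = r \<odot>\<^bsub>M\<^esub> t \<oplus>\<^bsub>M\<^esub> (r \<otimes> a) \<odot>\<^bsub>M\<^esub> x"
      using x r Tc by (auto simp: smult_r_distr smult_assoc1)
    then show ?thesis using submoduleE(4)[OF T r t(1)] R.m_closed[OF r t(2)] by blast
  qed
qed

lemma wf_submodules_of_span:
  assumes "finite S" "S \<subseteq> carrier M"
  shows "wf {(L', L). submodule L R M \<and> submodule L' R M \<and> L \<subset> L' \<and>
    L' \<subseteq> \<Inter>{H. submodule H R M \<and> S \<subseteq> H}}"
  using assms
proof (induction S)
  case empty
  have "submodule {\<zero>\<^bsub>M\<^esub>} R M" by (rule submoduleI) auto
  then have no_pair: "{(L', L). submodule L R M \<and> submodule L' R M \<and> L \<subset> L' \<and>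
    L' \<subseteq> \<Inter>{H. submodule H R M \<and> {} \<subseteq> H}} = {}"
    using submodule_zero_mem by blast
  show ?case unfolding no_pair by (simp add: wf_def)
next
  case (insert x S)
  let ?T = "\<Inter>{H. submodule H R M \<and> S \<subseteq> H}"
  let ?U = "{t \<oplus>\<^bsub>M\<^esub> a \<odot>\<^bsub>M\<^esub> x | t a. t \<in> ?T \<and> a \<in> carrier R}"
  have S: "S \<subseteq> carrier M" and x: "x \<in> carrier M" using insert.prems by auto
  have T: "submodule ?T R M" by (rule submodule_generated[OF S])
  have "x = \<zero>\<^bsub>M\<^esub> \<oplus>\<^bsub>M\<^esub> \<one> \<odot>\<^bsub>M\<^esub> x" using x by simp
  then have "x \<in> ?U" using submodule_zero_mem[OF T] R.one_closed by blast
  moreover have "s \<in> ?U" if "s \<in> S" for s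
  proof -
    have "s = s \<oplus>\<^bsub>M\<^esub> \<zero> \<odot>\<^bsub>M\<^esub> x" using that S x by auto
    then show ?thesis using that R.zero_closed by blast
  qed
  ultimately have "\<Inter>{H. submodule H R M \<and> insert x S \<subseteq> H} \<subseteq> ?U"
    using submodule_sum_cyclic[OF T x] by blast
  then show ?case
    by (rule wf_submodules_of_sum_cyclic[OF T x insert.IH[OF S]])
qed

lemma wf_submodules:
  assumes "fin_gen_module R M"
  shows "wf {(L', L). submodule L R M \<and> submodule L' R M \<and> L \<subset> L'}"
proof -
  obtain S where S: "finite S" "S \<subseteq> carrier M"
    and gen: "carrier M = \<Inter>{H. submodule H R M \<and> S \<subseteq> H}"
    using assms unfolding fin_gen_module_def by blast
  have "{(L', L). submodule L R M \<and> submodule L' R M \<and> L \<subset> L' \<and> L' \<subseteq> carrier M} =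
    {(L', L). submodule L R M \<and> submodule L' R M \<and> L \<subset> L'}"
    using submoduleE(1) by blast
  then show ?thesis using wf_submodules_of_span[OF S] gen by simp
qed

section \<open>The multiset of primes of a filtration\<close>

text \<open>A relation, because uniqueness of the multiset is only a consequence of the exchange
  property below.\<close>

definition RPE_factors :: "'c set \<Rightarrow> 'a set multiset \<Rightarrow> bool"
  where "RPE_factors N A \<longleftrightarrow> (\<exists>ps F. RPE_filtration R M N ps F \<and> A = mset ps)"

lemma RPE_factors_empty_iff: "RPE_factors N {#} \<longleftrightarrow> N = carrier M"
  by (auto simp: RPE_factors_def RPE_filtration_def)

lemma RPE_filtration_Cons_iff:
  "(\<exists>F. RPE_filtration R M N (p # ps) F) \<longleftrightarrow>
    (\<exists>L. regular_prime_extension R M p N L \<and> (\<exists>F. RPE_filtration R M L ps F))"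
proof
  assume "\<exists>F. RPE_filtration R M N (p # ps) F"
  then obtain F where F: "RPE_filtration R M N (p # ps) F" by blast
  then have "regular_prime_extension R M p N (F 1)"
    by (force simp: RPE_filtration_def)
  moreover have "RPE_filtration R M (F 1) ps (\<lambda>i. F (Suc i))"
    using F by (force simp: RPE_filtration_def)
  ultimately show "\<exists>L. regular_prime_extension R M p N L \<and> (\<exists>F. RPE_filtration R M L ps F)" by blast
next
  assume "\<exists>L. regular_prime_extension R M p N L \<and> (\<exists>F. RPE_filtration R M L ps F)"
  then obtain L F where L: "regular_prime_extension R M p N L" and F: "RPE_filtration R M L ps F"
    by blast
  have "RPE_filtration R M N (p # ps) (case_nat N F)"
    using L F by (auto simp: RPE_filtration_def less_Suc_eq_0_disj)
  then show "\<exists>F. RPE_filtration R M N (p # ps) F" by blast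
qed

lemma RPE_factors_add_mset:
  assumes N: "submodule N R M" and p: "maximal_Ass_mod N p"
    and A: "RPE_factors (colon_submodule M N p) A"
  shows "RPE_factors N (add_mset p A)"
proof -
  obtain ps where "\<exists>F. RPE_filtration R M (colon_submodule M N p) ps F" "A = mset ps"
    using A by (auto simp: RPE_factors_def)
  then show ?thesis
    using RPE_filtration_Cons_iff[of N p ps] regular_prime_extension_iff[OF N] p
    unfolding RPE_factors_def by (metis mset.simps(2))
qed

lemma RPE_factors_step:
  assumes N: "submodule N R M" and A: "RPE_factors N A" "A \<noteq> {#}"
  obtains p B where "A = add_mset p B" "maximal_Ass_mod N p" "submodule (colon_submodule M N p) R M"
    "RPE_factors (colon_submodule M N p) B"
proof -
  obtain ps F where ps: "RPE_filtration R M N ps F" "A = mset ps"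
    using A by (auto simp: RPE_factors_def)
  then obtain p qs where q: "ps = p # qs" using A(2) by (cases ps) auto
  then obtain L where L: "regular_prime_extension R M p N L" "\<exists>F. RPE_filtration R M L qs F"
    using ps RPE_filtration_Cons_iff by blast
  then have "maximal_Ass_mod N p" "L = colon_submodule M N p"
    using regular_prime_extension_iff[OF N] by auto
  then show thesis
    using that[of p "mset qs"] ps q L submodule_colon_Ass[OF N]
    by (auto simp: RPE_factors_def maximal_Ass_mod_def)
qed

lemma RPE_factors_exists:
  assumes "fin_gen_module R M" "submodule N R M"
  shows "\<exists>A. RPE_factors N A"
  using assms(2)
proof (induction N rule: wf_induct_rule[OF wf_submodules[OF assms(1)]])
  case (1 N)
  show ?case
  proof (cases "N = carrier M")
    case True
    then show ?thesis using RPE_factors_empty_iff by blast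
  next
    case False
    then obtain x where "x \<in> carrier M" "x \<notin> N" using submoduleE(1)[OF 1(2)] by blast
    then obtain p where p: "maximal_Ass_mod N p" using maximal_Ass_mod_above[OF 1(2)] by blast
    then have pA: "p \<in> Ass_mod N" by (simp add: maximal_Ass_mod_def)
    have "submodule (colon_submodule M N p) R M" by (rule submodule_colon_Ass[OF 1(2) pA])
    moreover have "N \<subset> colon_submodule M N p" by (rule colon_submodule_Ass_psubset[OF 1(2) pA])
    ultimately obtain A where "RPE_factors (colon_submodule M N p) A" using 1 by blast
    then show ?thesis using RPE_factors_add_mset[OF 1(2) p] by blast
  qed
qed

text \<open>The exchange property. If a filtration starts with \<open>p\<close> and \<open>q \<noteq> p\<close> is also maximal, then \<open>q\<close>
  is maximal for \<open>(N : p)\<close> and \<open>p\<close> is maximal for \<open>(N : q)\<close>, and both routes lead to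
  \<open>((N : p) : q) = ((N : q) : p)\<close>. By induction \<open>q\<close> can be removed from the
  filtration over \<open>(N : p)\<close>, and prefixing \<open>p\<close> to what remains gives a filtration over \<open>(N : q)\<close>.\<close>

lemma RPE_factors_remove:
  assumes "submodule N R M" "RPE_factors N A" "maximal_Ass_mod N q"
  shows "q \<in># A \<and> RPE_factors (colon_submodule M N q) (A - {#q#})"
  using assms
proof (induction "size A" arbitrary: N A)
  case 0
  then have "N = carrier M" using RPE_factors_empty_iff by simp
  then show ?case using 0 Ass_mod_carrier by (simp add: maximal_Ass_mod_def)
next
  case (Suc n)
  note N = Suc.prems(1) and q = Suc.prems(3)
  have "A \<noteq> {#}" using Suc.hyps(2) by auto
  then obtain p B where A: "A = add_mset p B" and p: "maximal_Ass_mod N p"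
    and Lp: "submodule (colon_submodule M N p) R M" and B: "RPE_factors (colon_submodule M N p) B"
    using RPE_factors_step[OF N Suc.prems(2)] by blast
  show ?case
  proof (cases "p = q")
    case True
    then show ?thesis using A B by simp
  next
    case False
    let ?L = "colon_submodule M (colon_submodule M N p) q"
    have pc: "p \<subseteq> carrier R" and qc: "q \<subseteq> carrier R" and qA: "q \<in> Ass_mod N"
      using p q Ass_mod_subset_carrier by (auto simp: maximal_Ass_mod_def)
    have "n = size B" using Suc.hyps(2) A by simp
    from Suc.hyps(1)[OF this Lp B maximal_Ass_mod_colon[OF N p q False]]
    have IH: "q \<in># B" "RPE_factors ?L (B - {#q#})" by auto
    have "?L = colon_submodule M (colon_submodule M N q) p"
      by (rule colon_submodule_commute[OF pc qc])
    then have "RPE_factors (colon_submodule M N q) (add_mset p (B - {#q#}))"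
      using RPE_factors_add_mset[OF submodule_colon_Ass[OF N qA]
          maximal_Ass_mod_colon[OF N q p False[symmetric]]] IH by simp
    then show ?thesis using IH(1) A False by auto
  qed
qed

lemma RPE_factors_unique:
  assumes "submodule N R M" "RPE_factors N A" "RPE_factors N B"
  shows "A = B"
  using assms
proof (induction "size A" arbitrary: N A B)
  case 0
  then have N: "N = carrier M" "A = {#}" using RPE_factors_empty_iff by auto
  have "B = {#}"
  proof (rule ccontr)
    assume "B \<noteq> {#}"
    then obtain p where "maximal_Ass_mod N p" using RPE_factors_step[OF 0(2,4)] by blast
    then show False using N Ass_mod_carrier by (simp add: maximal_Ass_mod_def)
  qed
  then show ?case using N by simp
next
  case (Suc n)
  have "A \<noteq> {#}" using Suc.hyps(2) by auto
  then obtain p C where A: "A = add_mset p C" and p: "maximal_Ass_mod N p"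
    and L: "submodule (colon_submodule M N p) R M" and C: "RPE_factors (colon_submodule M N p) C"
    using RPE_factors_step[OF Suc.prems(1,2)] by blast
  have B: "p \<in># B" "RPE_factors (colon_submodule M N p) (B - {#p#})"
    using RPE_factors_remove[OF Suc.prems(1,3) p] by auto
  have "n = size C" using Suc.hyps(2) A by simp
  from Suc.hyps(1)[OF this L C B(2)] show ?case using A B(1) by simp
qed

lemma prime_factorization_in_eqI:
  assumes "submodule N R M" "RPE_factors N A"
  shows "prime_factorization_in R M N = A"
  unfolding prime_factorization_in_def
proof (rule the_equality)
  show "\<exists>ps F. RPE_filtration R M N ps F \<and> A = mset ps" using assms(2) by (simp add: RPE_factors_def)
  show "B = A" if "\<exists>ps F. RPE_filtration R M N ps F \<and> B = mset ps" for B
    using RPE_factors_unique[OF assms(1) _ assms(2)] that by (simp add: RPE_factors_def)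
qed

section \<open>Pairwise incomparable factors\<close>

text \<open>The first factor \<open>p\<close> is contained in no other associated prime, so every associated prime apart
  from \<open>p\<close> survives the passage to \<open>(N : p)\<close>.\<close>

lemma Ass_mod_subset_RPE_factors:
  assumes "submodule N R M" "RPE_factors N A"
  shows "Ass_mod N \<subseteq> set_mset A"
  using assms
proof (induction "size A" arbitrary: N A)
  case 0
  then show ?case using RPE_factors_empty_iff Ass_mod_carrier by simp
next
  case (Suc n)
  have "A \<noteq> {#}" using Suc.hyps(2) by auto
  then obtain p B where A: "A = add_mset p B" and p: "maximal_Ass_mod N p"
    and L: "submodule (colon_submodule M N p) R M" and B: "RPE_factors (colon_submodule M N p) B"
    using RPE_factors_step[OF Suc.prems] by blast
  have pA: "p \<in> Ass_mod N" using p by (simp add: maximal_Ass_mod_def)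
  have "n = size B" using Suc.hyps(2) A by simp
  then have IH: "Ass_mod (colon_submodule M N p) \<subseteq> set_mset B" by (rule Suc.hyps(1)[OF _ L B])
  show ?case
  proof
    fix q assume q: "q \<in> Ass_mod N"
    show "q \<in># A"
    proof (cases "p \<subseteq> q")
      case True
      then have "p = q" using p q by (auto simp: maximal_Ass_mod_def)
      then show ?thesis using A by simp
    next
      case False
      then show ?thesis using Ass_mod_colonI[OF Suc.prems(1) pA q] IH A by auto
    qed
  qed
qed

text \<open>Every factor is the annihilator of an element modulo a member of the filtration, hence it
  contains the annihilator of this element modulo \<open>N\<close>.\<close>

lemma RPE_factors_contain_Ass_mod:
  assumes "submodule N R M" "RPE_factors N A" "p \<in># A"
  shows "\<exists>q\<in>Ass_mod N. q \<subseteq> p"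
  using assms
proof (induction "size A" arbitrary: N A)
  case 0
  then show ?case by simp
next
  case (Suc n)
  note N = Suc.prems(1)
  have "A \<noteq> {#}" using Suc.hyps(2) by auto
  then obtain r B where A: "A = add_mset r B" and r: "maximal_Ass_mod N r"
    and L: "submodule (colon_submodule M N r) R M" and B: "RPE_factors (colon_submodule M N r) B"
    using RPE_factors_step[OF N Suc.prems(2)] by blast
  have rA: "r \<in> Ass_mod N" using r by (simp add: maximal_Ass_mod_def)
  show ?case
  proof (cases "p = r")
    case True
    then show ?thesis using rA by blast
  next
    case False
    then have "p \<in># B" using Suc.prems(3) A by simp
    moreover have "n = size B" using Suc.hyps(2) A by simp
    ultimately obtain q where q: "q \<in> Ass_mod (colon_submodule M N r)" "q \<subseteq> p"
      using Suc.hyps(1)[OF _ L B] by blast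
    obtain x where x: "x \<in> carrier M" "primeideal q R" and qx: "q = ann_mod (colon_submodule M N r) x"
      by (rule Ass_modE[OF L q(1)])
    have "ann_mod N x \<subseteq> q"
      using colon_submodule_superset[OF N Ass_mod_subset_carrier[OF rA]]
      unfolding qx by (auto simp: mem_ann_mod)
    then show ?thesis using Ass_mod_below[OF N x(1,2)] q(2) by blast
  qed
qed

text \<open>So, by the exchange property, a filtration with pairwise incomparable factors can be rearranged
  to begin with any one of them.\<close>

lemma antichain_factor_maximal:
  assumes N: "submodule N R M" and A: "RPE_factors N A"
    and anti: "\<And>p q. p \<in># A \<Longrightarrow> q \<in># A \<Longrightarrow> \<not> p \<subset> q" and p: "p \<in># A"
  shows "maximal_Ass_mod N p"
proof -
  have sub: "Ass_mod N \<subseteq> set_mset A" by (rule Ass_mod_subset_RPE_factors[OF N A])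
  obtain q where q: "q \<in> Ass_mod N" "q \<subseteq> p" using RPE_factors_contain_Ass_mod[OF N A p] by blast
  then have "q = p" using anti[of q p] sub p by blast
  then show ?thesis using q sub anti[OF p] by (auto simp: maximal_Ass_mod_def)
qed

text \<open>Each factor \<open>p\<close> is maximal for \<open>N\<close>, for \<open>K\<close> and for \<open>N \<inter> K\<close>, so by the exchange property
  filtrations over all three may start with \<open>p\<close>; and \<open>(N : p) \<inter> (K : p) = (N \<inter> K : p)\<close>.\<close>

lemma RPE_factors_Int:
  assumes "submodule N R M" "submodule K R M" "RPE_factors N A" "RPE_factors K A"
    and "\<And>p q. p \<in># A \<Longrightarrow> q \<in># A \<Longrightarrow> \<not> p \<subset> q"
  shows "RPE_factors (N \<inter> K) A"
  using assms
proof (induction "size A" arbitrary: N K A)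
  case 0
  then show ?case using RPE_factors_empty_iff by simp
next
  case (Suc n)
  note N = Suc.prems(1) and K = Suc.prems(2) and anti = Suc.prems(5)
  have NK: "submodule (N \<inter> K) R M" by (rule submodule_Int[OF N K])
  obtain p where p: "p \<in># A" using Suc.hyps(2) by (metis multiset_nonemptyE nat.distinct(1) size_empty)
  have pN: "maximal_Ass_mod N p" by (rule antichain_factor_maximal[OF N Suc.prems(3) anti p])
  have pK: "maximal_Ass_mod K p" by (rule antichain_factor_maximal[OF K Suc.prems(4) anti p])
  have sub: "Ass_mod (N \<inter> K) \<subseteq> set_mset A"
    using Ass_mod_Int[OF N K] Ass_mod_subset_RPE_factors[OF N Suc.prems(3)]
      Ass_mod_subset_RPE_factors[OF K Suc.prems(4)] by blast
  have pA: "p \<in> Ass_mod N" using pN by (simp add: maximal_Ass_mod_def)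
  obtain x where x: "x \<in> carrier M" "primeideal p R" and px: "p = ann_mod N x"
    by (rule Ass_modE[OF N pA])
  have "ann_mod (N \<inter> K) x \<subseteq> p" by (simp add: px ann_mod_Int)
  then obtain q where q: "q \<in> Ass_mod (N \<inter> K)" "q \<subseteq> p"
    using Ass_mod_below[OF NK x] by blast
  then have "q = p" using anti[of q p] sub p by blast
  then have pNK: "maximal_Ass_mod (N \<inter> K) p"
    using q sub anti[OF p] by (auto simp: maximal_Ass_mod_def)
  have "RPE_factors (colon_submodule M N p \<inter> colon_submodule M K p) (A - {#p#})"
  proof (rule Suc.hyps(1))
    show "n = size (A - {#p#})" using Suc.hyps(2) p by (simp add: size_Diff_singleton)
    show "submodule (colon_submodule M N p) R M" "submodule (colon_submodule M K p) R M"
      using submodule_colon_Ass N K pN pK by (auto simp: maximal_Ass_mod_def)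
    show "RPE_factors (colon_submodule M N p) (A - {#p#})"
      using RPE_factors_remove[OF N Suc.prems(3) pN] by blast
    show "RPE_factors (colon_submodule M K p) (A - {#p#})"
      using RPE_factors_remove[OF K Suc.prems(4) pK] by blast
    show "\<not> r \<subset> q" if "r \<in># A - {#p#}" "q \<in># A - {#p#}" for r q
      using anti[of r q] that by (meson in_diffD)
  qed
  then have "RPE_factors (N \<inter> K) (add_mset p (A - {#p#}))"
    using RPE_factors_add_mset[OF NK pNK] colon_submodule_Int by simp
  then show ?case using p by simp
qed

end

theorem proposition2p2:
  fixes R :: "('a, 'r) ring_scheme" and M :: "('a, 'b, 'm) module_scheme"
    and N K :: "'b set" and ps :: "'a set list"
  assumes "cring R" and "noetherian_ring R"
    and "module R M" and "fin_gen_module R M"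
    and "submodule N R M" and "N \<noteq> carrier M"
    and "submodule K R M" and "K \<noteq> carrier M"
    and "\<forall>\<pp> \<in> set ps. primeideal \<pp> R"
    and "prime_factorization_in R M N = mset ps"
    and "prime_factorization_in R M K = mset ps"
    and "\<forall>i < length ps. \<forall>j < length ps. i \<noteq> j \<longrightarrow> \<not> ps ! j \<subset> ps ! i"
  shows "prime_factorization_in R M (N \<inter> K) = prime_factorization_in R M N"
proof -
  interpret module_over_noetherian R M
    using assms(2,3) by (simp add: module_over_noetherian_def module_over_noetherian_axioms_def)
  have factors: "RPE_factors L (mset ps)"
    if "submodule L R M" "prime_factorization_in R M L = mset ps" for L
    using RPE_factors_exists[OF assms(4) that(1)] prime_factorization_in_eqI[OF that(1)] that(2) by auto
  \<comment> \<open>Equal primes at different positions do not properly contain each other, so incomparability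
    of the entries is incomparability of the members.\<close>
  have "\<not> p \<subset> q" if "p \<in># mset ps" "q \<in># mset ps" for p q
    using that assms(12) by (metis in_set_conv_nth psubset_eq set_mset_mset)
  then have "RPE_factors (N \<inter> K) (mset ps)"
    by (rule RPE_factors_Int[OF assms(5,7) factors[OF assms(5,10)] factors[OF assms(7,11)]])
  then show ?thesis
    using prime_factorization_in_eqI[OF submodule_Int[OF assms(5,7)]] assms(10) by simp
qed

end
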